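(* Let $m\ge 2$ and $n\ge 1$ be integers and let $\mathcal{Q}=(\mathcal{A},\mathcal{B},-\mathcal{I})\in\mathcal{F}_{m,n}$, where $\mathcal{A}=(a_{i_1\ldots i_m})$, $\mathcal{B}=(b_{i_1\ldots i_m})$ and $\mathcal{I}$ is the unit tensor. Assume that $\mathcal{A}$ is strictly copositive. If $\mathcal{A}$ and $\mathcal{B}$ satisfy $$(a_{ii\ldots i}+1-m)(m-1)^{\frac1m-1}-b_{ii\ldots i}>0\quad\text{for all } i\in\{1,\ldots,n\},$$ then $\mathcal{Q}$ has at least one $m$-degree Pareto-eigenpair.
   Context: $\mathcal{T}_{m,n}$ is the space of real $m$-th order $n$-dimensional tensors $\mathcal{A}=(a_{i_1\ldots i_m})$, with no symmetry assumed, and $\mathcal{F}_{m,n}=\mathcal{T}_{m,n}\times\mathcal{T}_{m,n}\times\mathcal{T}_{m,n}$. The unit tensor $\mathcal{I}\in\mathcal{T}_{m,n}$ has entries $1$ when $i_1=\cdots=i_m$ and $0$ otherwise. For $x\in\mathbb{R}^n$, $\mathcal{A}x^{m-1}\in\mathbb{R}^n$ has $i$-th component $\sum_{i_2,\ldots,i_m=1}^n a_{ii_2\ldots i_m}x_{i_2}\cdots x_{i_m}$, and $\mathcal{A}x^m=\langle x,\mathcal{A}x^{m-1}\rangle$. $\mathcal{A}$ is strictly copositive if $\mathcal{A}x^m>0$ for all $x\in\mathbb{R}^n_+\setminus\{0\}$. $(\lambda,x)\in\mathbb{R}\times(\mathbb{R}^n\setminus\{0\})$ is an $m$-degree Pareto-eigenpair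 of $(\mathcal{A},\mathcal{B},\mathcal{C})$ if $x\ge 0$, $(\lambda^m\mathcal{A}+\lambda\mathcal{B}+\mathcal{C})x^{m-1}\ge 0$ (componentwise) and $\langle x,(\lambda^m\mathcal{A}+\lambda\mathcal{B}+\mathcal{C})x^{m-1}\rangle=0$. *)

theory Defs
  imports "HOL-Analysis.Analysis"
begin

text \<open>
  An \<open>m\<close>-th order tensor of dimension \<open>CARD('n)\<close> is a function on multi-indices, with
  \<open>A [i\<^sub>1, \<dots>, i\<^sub>m]\<close> the entry at \<open>(i\<^sub>1, \<dots>, i\<^sub>m)\<close>. The order is not part of the type: where a
  tensor is used at order \<open>m\<close>, only its values on lists of length \<open>m\<close> matter.
\<close>

type_synonym 'n tensor = "'n list \<Rightarrow> real"

definition unit_tensor :: "'n tensor" where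
  "unit_tensor is = (if \<exists>i. is = replicate (length is) i then 1 else 0)"

text \<open>\<open>tensor_vec m A x\<close> is \<open>A x\<^bsup>m-1\<^esup>\<close> and \<open>tensor_form m A x\<close> is \<open>A x\<^bsup>m\<^esup>\<close>, for \<open>m \<ge> 1\<close>.\<close>

definition tensor_vec :: "nat \<Rightarrow> 'n::finite tensor \<Rightarrow> real ^ 'n \<Rightarrow> real ^ 'n" where
  "tensor_vec m A x =
     (\<chi> i. \<Sum>is | length is = m - 1. A (i # is) * (\<Prod>j\<leftarrow>is. x $ j))"

text \<open>The sum above ranges over a finite set, so it is never a default value.\<close>

lemma finite_multi_indices: "finite {is :: 'n::finite list. length is = k}"
  using finite_lists_length_eq[of "UNIV :: 'n set" k] by simp

definition tensor_form :: "nat \<Rightarrow> 'n::finite tensor \<Rightarrow> real ^ 'n \<Rightarrow> real" where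
  "tensor_form m A x = x \<bullet> tensor_vec m A x"

text \<open>The order on \<^typ>\<open>real ^ 'n\<close> is componentwise, so \<open>0 \<le> x\<close> means that \<open>x\<close> lies in the
  nonnegative orthant.\<close>

definition strictly_copositive :: "nat \<Rightarrow> 'n::finite tensor \<Rightarrow> bool" where
  "strictly_copositive m A \<longleftrightarrow> (\<forall>x. 0 \<le> x \<and> x \<noteq> 0 \<longrightarrow> tensor_form m A x > 0)"

definition pareto_eigenpair ::
  "nat \<Rightarrow> 'n::finite tensor \<times> 'n tensor \<times> 'n tensor \<Rightarrow> real \<times> (real ^ 'n) \<Rightarrow> bool" where
  "pareto_eigenpair m = (\<lambda>(A, B, C) (l, x).
     let P = (\<lambda>is. l ^ m * A is + l * B is + C is) in
       x \<noteq> 0 \<and> 0 \<le> x \<and> 0 \<le> tensor_vec m P x \<and> x \<bullet> tensor_vec m P x = 0)"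

end

theory Submission
  imports Defs
begin

text \<open>
  Write \<open>P(l) = l\<^sup>m A + l B - I\<close> for the pencil. Its form \<open>P(l) x\<^sup>m\<close> is negative on the standard
  simplex at \<open>l = 0\<close>, where \<open>P(0) = - I\<close>, and positive there for some large \<open>l = L\<close>, since
  \<open>l\<^sup>m A\<close> then dominates and the strictly copositive form \<open>A x\<^sup>m\<close> is bounded away from \<open>0\<close> on the
  compact simplex. An eigenpair is sought between these two parameters.

  For a fixed \<open>l\<close>, Brouwer's theorem yields a point \<open>x\<close> of the simplex with
  \<open>P(l) x\<^bsup>m-1\<^esup> \<ge> P(l) x\<^sup>m\<close> in every component, and such an \<open>x\<close> is an eigenvector exactly if
  \<open>P(l) x\<^sup>m = 0\<close>. That point need not depend continuously on \<open>l\<close>, so an intermediate value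
  argument in \<open>l\<close> is not available. Instead the parameter is made one of the unknowns: on the
  product of the simplex with \<open>[0, L]\<close>, the variational inequality
  for the map \<open>(x, l) \<mapsto> (P(l) x\<^bsup>m-1\<^esup>, P(l) x\<^sup>m)\<close> has a solution. Its second component
  says that \<open>P(l) x\<^sup>m\<close> vanishes if \<open>l\<close> is interior, is nonnegative if \<open>l = 0\<close>, and is nonpositive
  if \<open>l = L\<close>; the sign conditions exclude both end points.
\<close>

text \<open>The fixed points of \<open>z \<mapsto> proj\<^sub>K (z - F z)\<close> are the solutions of the variational inequality,
  so Brouwer's theorem provides one.\<close>

lemma variational_inequality_solvable:
  fixes F :: "'a::euclidean_space \<Rightarrow> 'a"
  assumes "compact K" "convex K" "K \<noteq> {}" "continuous_on K F"
  obtains z where "z \<in> K" "\<And>w. w \<in> K \<Longrightarrow> F z \<bullet> (w - z) \<ge> 0"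
proof -
  let ?f = "\<lambda>z. closest_point K (z - F z)"
  have cl: "closed K" using assms(1) by (rule compact_imp_closed)
  have "continuous_on UNIV (closest_point K)"
    using continuous_on_closest_point[OF assms(2) cl assms(3)] .
  moreover have "continuous_on K (\<lambda>z. z - F z)"
    by (intro continuous_intros assms(4))
  ultimately have "continuous_on K ?f"
    by (rule continuous_on_compose2) auto
  moreover have "?f \<in> K \<rightarrow> K"
    using closest_point_in_set[OF cl assms(3)] by auto
  ultimately obtain z where z: "z \<in> K" "?f z = z"
    using brouwer[OF assms(1-3)] by blast
  have "F z \<bullet> (w - z) \<ge> 0" if "w \<in> K" for w
    using closest_point_dot[OF assms(2) cl that, of "z - F z"] z(2)
    by (simp add: inner_diff_left)
  with z(1) show thesis by (rule that)
qed

definition std_simplex :: "(real ^ 'n::finite) set" where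
  "std_simplex = {x. 0 \<le> x \<and> (\<Sum>i\<in>UNIV. x $ i) = 1}"

lemma axis_in_std_simplex: "axis i 1 \<in> std_simplex"
  by (auto simp: std_simplex_def less_eq_vec_def axis_def)

lemma std_simplex_nonneg: "x \<in> std_simplex \<Longrightarrow> 0 \<le> x"
  by (simp add: std_simplex_def)

lemma std_simplex_nonzero: "x \<in> std_simplex \<Longrightarrow> x \<noteq> 0"
  by (auto simp: std_simplex_def)

lemma convex_std_simplex: "convex (std_simplex :: (real ^ 'n::finite) set)"
  by (rule convexI)
    (auto simp: std_simplex_def less_eq_vec_def sum.distrib simp flip: sum_distrib_left)

lemma compact_std_simplex: "compact (std_simplex :: (real ^ 'n::finite) set)"
proof -
  have "std_simplex = (\<Inter>i. {x :: real ^ 'n. 0 \<le> x $ i}) \<inter> {x. (\<Sum>i\<in>UNIV. x $ i) = 1}"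
    by (auto simp: std_simplex_def less_eq_vec_def)
  moreover have "closed ((\<Inter>i. {x :: real ^ 'n. 0 \<le> x $ i}) \<inter> {x. (\<Sum>i\<in>UNIV. x $ i) = 1})"
    by (intro closed_Int closed_INT ballI closed_Collect_le closed_Collect_eq continuous_intros)
  ultimately have "closed (std_simplex :: (real ^ 'n) set)"
    by simp
  moreover have "norm x \<le> 1" if "x \<in> std_simplex" for x :: "real ^ 'n"
    using norm_le_l1_cart[of x] that by (simp add: std_simplex_def less_eq_vec_def)
  then have "bounded (std_simplex :: (real ^ 'n) set)"
    by (rule boundedI)
  ultimately show ?thesis
    by (simp add: compact_eq_bounded_closed)
qed

text \<open>An intermediate value theorem for nonlinear complementarity: if the pairing \<open>x \<bullet> H l x\<close>
  changes sign over the simplex between \<open>l = 0\<close> and \<open>l = L\<close>, then for some \<open>l\<close> in between the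
  complementarity problem of \<open>H l\<close> has a solution in the simplex. The variational inequality is
  posed in \<open>x\<close> and \<open>l\<close> together, with the pairing itself as the component in direction \<open>l\<close>.\<close>

lemma parametric_complementarity:
  fixes H :: "real \<Rightarrow> real ^ 'n::finite \<Rightarrow> real ^ 'n"
  assumes L: "L \<ge> 0"
    and cont: "continuous_on (std_simplex \<times> {0..L}) (\<lambda>(x, l). H l x)"
    and neg: "\<And>x. x \<in> std_simplex \<Longrightarrow> x \<bullet> H 0 x < 0"
    and pos: "\<And>x. x \<in> std_simplex \<Longrightarrow> x \<bullet> H L x > 0"
  obtains l x where "0 < l" "l < L" "x \<in> std_simplex" "0 \<le> H l x" "x \<bullet> H l x = 0"
proof -
  let ?K = "(std_simplex :: (real ^ 'n) set) \<times> {0..L}"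
  let ?F = "\<lambda>(x, l). (H l x, x \<bullet> H l x)"
  have "continuous_on ?K ?F"
    using cont by (auto simp: case_prod_beta intro!: continuous_intros)
  moreover have "compact ?K" "convex ?K"
    by (auto intro: compact_Times compact_std_simplex convex_Times convex_std_simplex)
  moreover have "?K \<noteq> {}"
    using axis_in_std_simplex L by fastforce
  ultimately obtain z where z: "z \<in> ?K" "\<And>w. w \<in> ?K \<Longrightarrow> ?F z \<bullet> (w - z) \<ge> 0"
    using variational_inequality_solvable[of ?K ?F] by blast
  obtain x l where zeq: "z = (x, l)" by force
  have x: "x \<in> std_simplex" and l: "0 \<le> l" "l \<le> L"
    using z(1) zeq by auto
  have vi: "H l x \<bullet> (y - x) + (x \<bullet> H l x) * (t - l) \<ge> 0"
    if "y \<in> std_simplex" "0 \<le> t" "t \<le> L" for y t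
    using z(2)[of "(y, t)"] that by (simp add: zeq)
  have "l \<noteq> 0"
  proof
    assume "l = 0"
    with vi[of x L] x L neg[OF x] pos[OF x] show False
      by (cases "L = 0") (auto simp: zero_le_mult_iff)
  qed
  moreover have "l \<noteq> L"
  proof
    assume "l = L"
    with vi[of x 0] x L pos[OF x] \<open>l \<noteq> 0\<close> show False
      by (auto simp: mult_le_0_iff)
  qed
  ultimately have l': "0 < l" "l < L" using l by auto
  then have s: "x \<bullet> H l x = 0"
    using vi[of x 0] vi[of x L] x L by (auto simp: zero_le_mult_iff mult_le_0_iff)
  have "0 \<le> H l x $ i" for i
    using vi[of "axis i 1" l] axis_in_std_simplex[of i] l s
    by (simp add: inner_diff_right inner_axis inner_commute[of x])
  then show thesis
    using that[OF l' x _ s] by (simp add: less_eq_vec_def)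
qed

lemma tensor_vec_pencil:
  "tensor_vec m (\<lambda>is. a * A is + b * B is + - C is) x
     = a *\<^sub>R tensor_vec m A x + b *\<^sub>R tensor_vec m B x - tensor_vec m C x"
  by (simp add: tensor_vec_def vec_eq_iff sum_distrib_left algebra_simps
      flip: sum.distrib sum_subtractf)

lemma continuous_on_tensor_vec [continuous_intros]:
  assumes "continuous_on S f"
  shows "continuous_on S (\<lambda>z. tensor_vec m A (f z))"
proof -
  have "continuous_on S (\<lambda>z. \<Prod>j\<leftarrow>is. f z $ j)" for "is"
    by (induction "is") (auto intro!: continuous_intros assms)
  then show ?thesis
    unfolding tensor_vec_def by (intro continuous_intros)
qed

lemma tensor_vec_unit:
  assumes "m \<ge> 1"
  shows "tensor_vec m unit_tensor x $ i = (x $ i) ^ (m - 1)"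
proof -
  have u: "unit_tensor (i # is) = (if is = replicate (m - 1) i then 1 else 0)"
    if "length is = m - 1" for "is" :: "'a list"
    using that by (auto simp: unit_tensor_def)
  have "tensor_vec m unit_tensor x $ i
      = (\<Sum>is | length is = m - 1. if is = replicate (m - 1) i then \<Prod>j\<leftarrow>is. x $ j else 0)"
    unfolding tensor_vec_def by (auto simp: u intro!: sum.cong)
  also have "\<dots> = (x $ i) ^ (m - 1)"
    by (simp add: finite_multi_indices prod_list_replicate)
  finally show ?thesis .
qed

lemma strictly_copositive_unit_tensor:
  assumes "m \<ge> 1"
  shows "strictly_copositive m unit_tensor"
  unfolding strictly_copositive_def
proof (intro allI impI)
  fix x :: "real ^ 'n" assume x: "0 \<le> x \<and> x \<noteq> 0"
  then obtain k where "x $ k \<noteq> 0" by (auto simp: vec_eq_iff)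
  with x have k: "x $ k > 0" by (simp add: less_eq_vec_def order_less_le)
  have "(\<Sum>i\<in>UNIV. x $ i * (x $ i) ^ (m - 1)) > 0"
    using x k by (intro sum_pos2[of _ k]) (auto simp: less_eq_vec_def)
  then show "tensor_form m unit_tensor x > 0"
    by (simp add: tensor_form_def inner_vec_def tensor_vec_unit[OF assms])
qed

lemma continuous_on_tensor_form: "continuous_on S (tensor_form m A)"
  unfolding tensor_form_def by (intro continuous_intros)

lemma pencil_form_eventually_positive:
  fixes A B C :: "'n::finite tensor"
  assumes m: "m \<ge> 2" and A: "strictly_copositive m A"
  obtains L where "L > 0"
    "\<And>x. x \<in> std_simplex \<Longrightarrow>
       L ^ m * tensor_form m A x + L * tensor_form m B x - tensor_form m C x > 0"
proof -
  let ?D = "std_simplex :: (real ^ 'n) set"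
  have ne: "?D \<noteq> {}" using axis_in_std_simplex by blast
  obtain y where y: "y \<in> ?D" "\<And>x. x \<in> ?D \<Longrightarrow> tensor_form m A y \<le> tensor_form m A x"
    using continuous_attains_inf[OF compact_std_simplex ne continuous_on_tensor_form] by blast
  define a where "a = tensor_form m A y"
  have a: "a > 0"
    using A y(1) std_simplex_nonneg std_simplex_nonzero
    unfolding a_def strictly_copositive_def by blast
  have "continuous_on ?D (\<lambda>x. \<bar>tensor_form m B x\<bar> + \<bar>tensor_form m C x\<bar>)"
    by (intro continuous_intros continuous_on_tensor_form)
  then obtain w where w: "\<And>x. x \<in> ?D \<Longrightarrow>
      \<bar>tensor_form m B x\<bar> + \<bar>tensor_form m C x\<bar> \<le> \<bar>tensor_form m B w\<bar> + \<bar>tensor_form m C w\<bar>"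
    using continuous_attains_sup[OF compact_std_simplex ne] by blast
  define b where "b = \<bar>tensor_form m B w\<bar> + \<bar>tensor_form m C w\<bar>"
  have b: "b \<ge> 0" by (simp add: b_def)
  \<comment> \<open>For \<open>L \<ge> 1\<close> the form is at least \<open>L\<^sup>2 a - L b\<close>, and \<open>L a > b\<close> makes this positive.\<close>
  define L where "L = b / a + 1"
  have L: "L \<ge> 1" "L * a > b" using a b by (auto simp: L_def field_simps)
  show thesis
  proof (rule that[of L])
    show "L > 0" using L by simp
    fix x assume x: "x \<in> ?D"
    have "L * b < L * (L * a)" using L by simp
    also have "\<dots> = L ^ 2 * a" by (simp add: power2_eq_square)
    also have "\<dots> \<le> L ^ m * tensor_form m A x"
      using y(2)[OF x] a L m
      by (intro mult_mono power_increasing) (auto simp: a_def)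
    finally have 1: "L * b < L ^ m * tensor_form m A x" .
    have "L * \<bar>tensor_form m B x\<bar> + \<bar>tensor_form m C x\<bar>
        \<le> L * (\<bar>tensor_form m B x\<bar> + \<bar>tensor_form m C x\<bar>)"
      using L mult_right_mono[of 1 L "\<bar>tensor_form m C x\<bar>"] by (simp add: distrib_left)
    also have "\<dots> \<le> L * b"
      using w[OF x] L by (simp add: b_def)
    finally have 2: "L * \<bar>tensor_form m B x\<bar> + \<bar>tensor_form m C x\<bar> \<le> L * b" .
    have "- (L * \<bar>tensor_form m B x\<bar>) \<le> L * tensor_form m B x"
      using L mult_left_mono[of "- \<bar>tensor_form m B x\<bar>" "tensor_form m B x" L] by simp
    with 1 2 show
      "L ^ m * tensor_form m A x + L * tensor_form m B x - tensor_form m C x > 0"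
      by linarith
  qed
qed

theorem theorem4p2:
  fixes m :: nat and A B :: "'n::finite tensor"
  assumes "m \<ge> 2"
    and "strictly_copositive m A"
    and "\<And>i. (A (replicate m i) + 1 - real m) * (real m - 1) powr (1 / real m - 1)
               - B (replicate m i) > 0"
  shows "\<exists>p. pareto_eigenpair m (A, B, \<lambda>is. - unit_tensor is) p"
proof -
  let ?H = "\<lambda>l x. tensor_vec m (\<lambda>is. l ^ m * A is + l * B is + - unit_tensor is) x"
  have form: "x \<bullet> ?H l x
      = l ^ m * tensor_form m A x + l * tensor_form m B x - tensor_form m unit_tensor x" for l x
    unfolding tensor_vec_pencil by (simp add: tensor_form_def inner_add_right inner_diff_right)
  obtain L where L: "L > 0"
    "\<And>x. x \<in> std_simplex \<Longrightarrow>
       L ^ m * tensor_form m A x + L * tensor_form m B x - tensor_form m unit_tensor x > 0"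
    using pencil_form_eventually_positive[OF assms(1,2), of B unit_tensor] by blast
  have "strictly_copositive m (unit_tensor :: 'n tensor)"
    using assms(1) by (intro strictly_copositive_unit_tensor) simp
  then have neg: "x \<bullet> ?H 0 x < 0" if "x \<in> std_simplex" for x
    using assms(1) std_simplex_nonneg[OF that] std_simplex_nonzero[OF that]
    unfolding form by (simp add: strictly_copositive_def power_0_left)
  have pos: "x \<bullet> ?H L x > 0" if "x \<in> std_simplex" for x
    using L(2)[OF that] unfolding form .
  have "continuous_on (std_simplex \<times> {0..L}) (\<lambda>(x, l). ?H l x)"
    unfolding tensor_vec_pencil case_prod_beta by (intro continuous_intros)
  then obtain l x where x: "x \<in> std_simplex" and "0 \<le> ?H l x" "x \<bullet> ?H l x = 0"
    using parametric_complementarity[of L ?H, OF less_imp_le[OF L(1)] _ neg pos] by blast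
  then have "pareto_eigenpair m (A, B, \<lambda>is. - unit_tensor is) (l, x)"
    using std_simplex_nonneg[OF x] std_simplex_nonzero[OF x] by (simp add: pareto_eigenpair_def)
  then show ?thesis ..
qed

end
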